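(* Let $R$ be an integral domain, let $\star$ be a semistar operation of finite type on $R$, and let $I$ be a quasi-$\star$-ideal of $R$. If every minimal prime ideal of $I$ is the radical of a $\star$-finite ideal of $R$, then $I$ has only finitely many minimal prime ideals.
   Context: $R$ is a commutative integral domain with identity and quotient field $K$. Let $\overline{\mathcal{F}}(R)$ be the set of all nonzero $R$-submodules of $K$, and $f(R)$ the set of all nonzero finitely generated fractional ideals of $R$ (i.e. nonzero finitely generated $R$-submodules of $K$). A semistar operation on $R$ is a map $\star:\overline{\mathcal{F}}(R)\to\overline{\mathcal{F}}(R)$, $E\mapsto E^{\star}$, such that for all $0\neq x\in K$ and all $E,F\in\overline{\mathcal{F}}(R)$: (1) $(xE)^{\star}=xE^{\star}$; (2) $E\subseteq F$ implies $E^{\star}\subseteq F^{\star}$; (3) $E\subseteq E^{\star}$ and $(E^{\star})^{\star}=E^{\star}$. The operation $\star_f$ is defined by $E^{\star_f}=\bigcup\{F^{\star} : F\in f(R), F\subseteq E\}$; it is again a semistar operation, and $\star$ is of finite type if $\star=\star_f$. A nonzero ideal $I$ of $R$ is a quasi-$\star$-ideal if $I^{\star}\cap R=I$. An element $E\in\overline{\mathcal{F}}(R)$ is $\star$-finite if $E^{\star}=F^{\star}$ for some $F\in f(R)$. A minimal prime ideal of $I$ is a prime ideal of $R$ minimal among the primes containing $I$. *)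

theory Defs
  imports Complex_Main "HOL-Computational_Algebra.Polynomial_Factorial"
begin

text \<open>
  The integral domain $R$ is the type \<^typ>\<open>'a::idom\<close>, its quotient field $K$ is
  \<^typ>\<open>'a fract\<close>, and $R$ sits inside $K$ via \<^const>\<open>to_fract\<close>. Thus an ideal \<^term>\<open>J\<close>
  of $R$, regarded as a submodule of $K$, is \<^term>\<open>to_fract ` J\<close>.
\<close>

section \<open>Submodules of the quotient field\<close>

definition fract_scale :: "'a::idom \<Rightarrow> 'a fract \<Rightarrow> 'a fract" where
  "fract_scale r x = to_fract r * x"

lemma module_fract_scale: "module fract_scale"
  by unfold_locales (simp_all add: fract_scale_def algebra_simps)

definition nonzero_submodules :: "'a::idom fract set set" where
  "nonzero_submodules = {E. module.subspace fract_scale E \<and> E \<noteq> {0}}"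

definition fg_fractional_ideals :: "'a::idom fract set set" where
  "fg_fractional_ideals =
     {F \<in> nonzero_submodules. \<exists>S. finite S \<and> F = module.span fract_scale S}"

section \<open>Ideals of the domain\<close>

lemma module_times: "module ((*) :: 'a::comm_ring_1 \<Rightarrow> 'a \<Rightarrow> 'a)"
  by unfold_locales (simp_all add: algebra_simps)

definition is_ideal :: "'a::comm_ring_1 set \<Rightarrow> bool" where
  "is_ideal I \<longleftrightarrow> module.subspace (*) I"

definition prime_ideal :: "'a::comm_ring_1 set \<Rightarrow> bool" where
  "prime_ideal P \<longleftrightarrow>
     is_ideal P \<and> P \<noteq> UNIV \<and> (\<forall>a b. a * b \<in> P \<longrightarrow> a \<in> P \<or> b \<in> P)"

definition ideal_radical :: "'a::comm_ring_1 set \<Rightarrow> 'a set" where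
  "ideal_radical J = {x. \<exists>n. x ^ n \<in> J}"

definition minimal_primes :: "'a::comm_ring_1 set \<Rightarrow> 'a set set" where
  "minimal_primes I =
     {P. prime_ideal P \<and> I \<subseteq> P \<and> (\<forall>Q. prime_ideal Q \<and> I \<subseteq> Q \<and> Q \<subseteq> P \<longrightarrow> Q = P)}"

section \<open>Semistar operations\<close>

text \<open>
  A semistar operation is a total function on sets of which only the values on
  \<^const>\<open>nonzero_submodules\<close> are meaningful; its values elsewhere are arbitrary and are
  never used.
\<close>

definition semistar_operation :: "('a::idom fract set \<Rightarrow> 'a fract set) \<Rightarrow> bool" where
  "semistar_operation star \<longleftrightarrow>
     (\<forall>E \<in> nonzero_submodules. star E \<in> nonzero_submodules) \<and>
     (\<forall>x. \<forall>E \<in> nonzero_submodules. x \<noteq> 0 \<longrightarrow> star ((*) x ` E) = (*) x ` star E) \<and>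
     (\<forall>E \<in> nonzero_submodules. \<forall>F \<in> nonzero_submodules. E \<subseteq> F \<longrightarrow> star E \<subseteq> star F) \<and>
     (\<forall>E \<in> nonzero_submodules. E \<subseteq> star E \<and> star (star E) = star E)"

definition semistar_f ::
    "('a::idom fract set \<Rightarrow> 'a fract set) \<Rightarrow> 'a fract set \<Rightarrow> 'a fract set" where
  "semistar_f star E = \<Union> {star F | F. F \<in> fg_fractional_ideals \<and> F \<subseteq> E}"

definition finite_type :: "('a::idom fract set \<Rightarrow> 'a fract set) \<Rightarrow> bool" where
  "finite_type star \<longleftrightarrow> (\<forall>E \<in> nonzero_submodules. star E = semistar_f star E)"

definition quasi_star_ideal :: "('a::idom fract set \<Rightarrow> 'a fract set) \<Rightarrow> 'a set \<Rightarrow> bool" where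
  "quasi_star_ideal star I \<longleftrightarrow>
     is_ideal I \<and> I \<noteq> {0} \<and> star (to_fract ` I) \<inter> range to_fract = to_fract ` I"

definition star_finite :: "('a::idom fract set \<Rightarrow> 'a fract set) \<Rightarrow> 'a fract set \<Rightarrow> bool" where
  "star_finite star E \<longleftrightarrow>
     E \<in> nonzero_submodules \<and> (\<exists>F \<in> fg_fractional_ideals. star E = star F)"

end

theory Submission
  imports Defs "HOL-Library.Set_Algebras"
begin

text \<open>
  Fix, for each minimal prime \<open>P\<close> of \<open>I\<close>, an ideal \<open>J P\<close> as in the hypothesis. Since \<open>star\<close> has
  finite type, \<open>J P\<close> contains a finite set \<open>S P\<close> that decides membership in quasi-star-ideals: such
  an ideal contains \<open>J P\<close> as soon as it contains \<open>S P\<close> (\<open>star_finite_has_finite_test_set\<close>).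
  Look at the finite products \<open>S P\<^sub>1 * \<dots> * S P\<^sub>n\<close>, which are finite sets of ring elements.

  If some product lies in \<open>I\<close>, then each minimal prime \<open>Q\<close> contains one of the corresponding
  \<open>J P\<^sub>i\<close>, hence its radical \<open>P\<^sub>i\<close>, and \<open>Q = P\<^sub>i\<close> by minimality. So there are at most \<open>n\<close> minimal
  primes.

  If no product lies in \<open>I\<close>, Zorn's lemma gives a quasi-star-ideal \<open>M \<supseteq> I\<close> that is maximal among
  those containing no product; finite type is used again to see that unions of chains of
  quasi-star-ideals are quasi-star-ideals. As usual for such maximal objects, \<open>M\<close> is prime. But
  then \<open>M\<close> contains a minimal prime \<open>P\<close> of \<open>I\<close>, and so the one-term product \<open>S P\<close>, a contradiction.

  The usual proof that \<open>M\<close> is prime multiplies the star closures of \<open>M + aR\<close> and \<open>M + bR\<close>. Here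
  ideal quotients replace these sums: a quotient of a quasi-star-ideal is again a quasi-star-ideal
  because \<open>star\<close> commutes with scaling by one element, so products of submodules never have to
  be compared with \<open>star\<close>. The counting therefore takes place in any family of ideals closed
  under quotients and unions of chains (\<open>finite_minimal_primes_of_finite_test_sets\<close>), and
  semistar operations enter only to supply such a family and the sets \<open>S P\<close>.
\<close>

section \<open>Ideals, quotients and minimal primes\<close>

lemma is_ideal_iff:
  "is_ideal I \<longleftrightarrow> 0 \<in> I \<and> (\<forall>x\<in>I. \<forall>y\<in>I. x + y \<in> I) \<and> (\<forall>c. \<forall>x\<in>I. c * x \<in> I)"
  by (simp add: is_ideal_def module.subspace_def[OF module_times])

lemma ideal_Union_chain:
  assumes "\<C> \<noteq> {}" "subset.chain \<A> \<C>" "\<And>A. A \<in> \<C> \<Longrightarrow> is_ideal A"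
  shows "is_ideal (\<Union>\<C>)"
  unfolding is_ideal_iff
proof (intro conjI ballI allI)
  show "0 \<in> \<Union>\<C>"
    using assms(1,3) by (auto simp: is_ideal_iff)
  show "c * x \<in> \<Union>\<C>" if "x \<in> \<Union>\<C>" for c x
    using that assms(3) unfolding is_ideal_iff by blast
  show "x + y \<in> \<Union>\<C>" if "x \<in> \<Union>\<C>" "y \<in> \<Union>\<C>" for x y
  proof -
    have "finite {x, y}" "{x, y} \<subseteq> \<Union>\<C>"
      using that by auto
    then obtain B where "B \<in> \<C>" "{x, y} \<subseteq> B"
      using assms(1,2) by (rule finite_subset_Union_chain)
    then show ?thesis
      using assms(3)[of B] by (auto simp: is_ideal_iff)
  qed
qed

definition ideal_quotient :: "'a::comm_ring_1 set \<Rightarrow> 'a set \<Rightarrow> 'a set" where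
  "ideal_quotient A T = {x. \<forall>t\<in>T. x * t \<in> A}"

lemma ideal_quotient_ideal: "is_ideal A \<Longrightarrow> is_ideal (ideal_quotient A T)"
  by (auto simp: is_ideal_iff ideal_quotient_def distrib_right mult.assoc)

lemma ideal_subset_quotient: "is_ideal A \<Longrightarrow> A \<subseteq> ideal_quotient A T"
  by (auto simp: is_ideal_iff ideal_quotient_def) (metis mult.commute)

text \<open>
  Zorn's lemma is applied to complements, because the primes between \<open>I\<close> and \<open>P\<close> have to be
  minimised; the intersection of a chain of primes is prime.
\<close>

lemma prime_contains_minimal_prime:
  assumes "prime_ideal P" "I \<subseteq> P"
  obtains Q where "Q \<in> minimal_primes I" "Q \<subseteq> P"
proof -
  define \<A> where "\<A> = {U. prime_ideal (- U) \<and> I \<subseteq> - U \<and> - U \<subseteq> P}"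
  have "\<exists>M\<in>\<A>. \<forall>X\<in>\<A>. M \<subseteq> X \<longrightarrow> X = M"
  proof (rule subset_Zorn_nonempty)
    show "\<A> \<noteq> {}"
      using assms by (auto simp: \<A>_def intro: exI[of _ "- P"])
  next
    fix \<C>
    assume ne: "\<C> \<noteq> {}" and chain: "subset.chain \<A> \<C>"
    then have mem: "\<And>U. U \<in> \<C> \<Longrightarrow> prime_ideal (- U) \<and> I \<subseteq> - U \<and> - U \<subseteq> P"
      by (auto simp: \<A>_def subset_chain_def)
    have "prime_ideal (- \<Union>\<C>)"
      unfolding prime_ideal_def
    proof (intro conjI allI impI)
      show "is_ideal (- \<Union>\<C>)"
        using mem unfolding prime_ideal_def is_ideal_iff Compl_iff Union_iff by blast
      show "- \<Union>\<C> \<noteq> UNIV"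
      proof -
        obtain U where "U \<in> \<C>"
          using ne by blast
        with mem[of U] have "- U \<noteq> UNIV"
          by (simp add: prime_ideal_def)
        with \<open>U \<in> \<C>\<close> show ?thesis
          by blast
      qed
      show "a \<in> - \<Union>\<C> \<or> b \<in> - \<Union>\<C>" if "a * b \<in> - \<Union>\<C>" for a b
      proof (rule ccontr)
        assume "\<not> (a \<in> - \<Union>\<C> \<or> b \<in> - \<Union>\<C>)"
        then have "finite {a, b}" "{a, b} \<subseteq> \<Union>\<C>"
          by auto
        then obtain U where "U \<in> \<C>" "{a, b} \<subseteq> U"
          using ne chain by (rule finite_subset_Union_chain)
        then show False
          using mem[of U] that by (auto simp: prime_ideal_def)
      qed
    qed
    then show "\<Union>\<C> \<in> \<A>"
      using mem ne unfolding \<A>_def by blast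
  qed
  then obtain M where "M \<in> \<A>" and max: "\<And>X. X \<in> \<A> \<Longrightarrow> M \<subseteq> X \<Longrightarrow> X = M"
    by auto
  have "Q = - M" if "prime_ideal Q" "I \<subseteq> Q" "Q \<subseteq> - M" for Q
    using max[of "- Q"] that \<open>M \<in> \<A>\<close> by (auto simp: \<A>_def)
  with \<open>M \<in> \<A>\<close> have "- M \<in> minimal_primes I" "- M \<subseteq> P"
    by (auto simp: minimal_primes_def \<A>_def)
  then show thesis ..
qed

lemma prime_ideal_radical_subset:
  assumes "prime_ideal Q" "J \<subseteq> Q"
  shows "ideal_radical J \<subseteq> Q"
proof
  fix x
  assume "x \<in> ideal_radical J"
  then obtain n where "x ^ n \<in> Q"
    using assms(2) by (auto simp: ideal_radical_def)
  \<comment> \<open>This excludes \<open>n = 0\<close>.\<close>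
  moreover have "1 \<notin> Q"
    using assms(1) by (auto simp: prime_ideal_def is_ideal_iff) (metis UNIV_eq_I mult.right_neutral)
  ultimately show "x \<in> Q"
    using assms(1) by (induction n) (auto simp: prime_ideal_def)
qed

lemma subset_ideal_radical: "J \<subseteq> ideal_radical J"
  by (auto simp: ideal_radical_def intro: exI[of _ 1])


section \<open>Families of ideals closed under quotients and unions of chains\<close>

text \<open>
  A finite set \<open>S\<close> of elements of \<open>J\<close> that generates \<open>J\<close> as far as the family \<open>\<Q>\<close> can tell.
\<close>

definition finite_test_set :: "'a set set \<Rightarrow> 'a set \<Rightarrow> 'a set \<Rightarrow> bool" where
  "finite_test_set \<Q> J S \<longleftrightarrow> finite S \<and> S \<subseteq> J \<and> (\<forall>A\<in>\<Q>. S \<subseteq> A \<longrightarrow> J \<subseteq> A)"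

locale quotient_chain_closed =
  fixes \<Q> :: "'a::comm_ring_1 set set"
  assumes ideal: "A \<in> \<Q> \<Longrightarrow> is_ideal A"
    and quotient: "A \<in> \<Q> \<Longrightarrow> ideal_quotient A T \<in> \<Q>"
    and Union_chain: "\<C> \<noteq> {} \<Longrightarrow> subset.chain \<Q> \<C> \<Longrightarrow> \<Union>\<C> \<in> \<Q>"
begin

text \<open>
  The hypothesis on the product only concerns the test sets; the step to the ideals \<open>J P\<close> is made
  one factor at a time: an element \<open>j \<in> J P\<close> outside \<open>Q\<close> can be moved into the quotient of \<open>A\<close> by
  \<open>j\<close>, which still lies in \<open>Q\<close> and contains the product of the remaining test sets.
\<close>

lemma prime_over_product_contains_factor:
  assumes "prime_ideal Q" "A \<in> \<Q>" "A \<subseteq> Q" "prod_list (map S Ps) \<subseteq> A"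
    and "\<And>P. P \<in> set Ps \<Longrightarrow> finite_test_set \<Q> (J P) (S P)"
  shows "\<exists>P\<in>set Ps. J P \<subseteq> Q"
  using assms(2-5)
proof (induction Ps arbitrary: A)
  case Nil
  then have "1 \<in> Q"
    by auto
  then show ?case
    using assms(1) by (auto simp: prime_ideal_def is_ideal_iff) (metis UNIV_eq_I mult.right_neutral)
next
  case (Cons P Ps)
  show ?case
  proof (cases "J P \<subseteq> Q")
    case False
    then obtain j where j: "j \<in> J P" "j \<notin> Q"
      by auto
    have "prod_list (map S Ps) \<subseteq> ideal_quotient A {j}"
    proof
      fix t
      assume t: "t \<in> prod_list (map S Ps)"
      have "S P \<subseteq> ideal_quotient A {t}"
        using Cons.prems(3) t by (auto simp: ideal_quotient_def)
      then have "J P \<subseteq> ideal_quotient A {t}"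
        using Cons.prems(1,4) quotient by (auto simp: finite_test_set_def)
      then show "t \<in> ideal_quotient A {j}"
        using j by (auto simp: ideal_quotient_def mult.commute)
    qed
    moreover have "ideal_quotient A {j} \<subseteq> Q"
      using assms(1) j Cons.prems(2) by (auto simp: ideal_quotient_def prime_ideal_def)
    ultimately show ?thesis
      using Cons.IH[of "ideal_quotient A {j}"] Cons.prems quotient by auto
  qed auto
qed

text \<open>
  For the primality of a maximal \<open>M\<close>: if \<open>a * b \<in> M\<close> and \<open>a \<notin> M\<close>, the quotient of \<open>M\<close> by \<open>b\<close> is
  strictly larger than \<open>M\<close>, so it contains a product \<open>\<Pi>\<close>. Then \<open>b\<close> lies in the quotient of \<open>M\<close> by
  \<open>\<Pi>\<close>. If \<open>b \<notin> M\<close>, this quotient also contains a product \<open>\<Pi>'\<close>, and the product \<open>\<Pi>' * \<Pi>\<close> lies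
  in \<open>M\<close>.
\<close>

lemma prime_avoiding_products:
  assumes "I \<in> \<Q>"
    and finite: "\<And>P. P \<in> X \<Longrightarrow> finite (S P)"
    and avoid: "\<And>Ps. set Ps \<subseteq> X \<Longrightarrow> \<not> prod_list (map S Ps) \<subseteq> I"
  obtains M where "prime_ideal M" "I \<subseteq> M" "\<And>Ps. set Ps \<subseteq> X \<Longrightarrow> \<not> prod_list (map S Ps) \<subseteq> M"
proof -
  define \<A> where
    "\<A> = {A \<in> \<Q>. I \<subseteq> A \<and> (\<forall>Ps. set Ps \<subseteq> X \<longrightarrow> \<not> prod_list (map S Ps) \<subseteq> A)}"
  have finite_product: "finite (prod_list (map S Ps))" if "set Ps \<subseteq> X" for Ps
    using that by (induction Ps) (auto intro: finite_set_times finite)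
  have "\<exists>M\<in>\<A>. \<forall>A\<in>\<A>. M \<subseteq> A \<longrightarrow> A = M"
  proof (rule subset_Zorn_nonempty)
    show "\<A> \<noteq> {}"
      using assms(1) avoid by (auto simp: \<A>_def)
  next
    fix \<C>
    assume ne: "\<C> \<noteq> {}" and chain: "subset.chain \<A> \<C>"
    have "\<Union>\<C> \<in> \<Q>"
      using chain by (intro Union_chain[OF ne]) (auto simp: \<A>_def subset_chain_def)
    moreover have "I \<subseteq> \<Union>\<C>"
      using ne chain by (fastforce simp: \<A>_def subset_chain_def)
    moreover have "\<not> prod_list (map S Ps) \<subseteq> \<Union>\<C>" if Ps: "set Ps \<subseteq> X" for Ps
    proof
      assume "prod_list (map S Ps) \<subseteq> \<Union>\<C>"
      then obtain A where "A \<in> \<C>" "prod_list (map S Ps) \<subseteq> A"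
        using finite_subset_Union_chain finite_product[OF Ps] ne chain by metis
      then show False
        using chain Ps by (auto simp: \<A>_def subset_chain_def)
    qed
    ultimately show "\<Union>\<C> \<in> \<A>"
      by (auto simp: \<A>_def)
  qed
  then obtain M where "M \<in> \<A>" and max: "\<And>A. A \<in> \<A> \<Longrightarrow> M \<subseteq> A \<Longrightarrow> A = M"
    by auto
  then have M: "M \<in> \<Q>" "I \<subseteq> M" "\<And>Ps. set Ps \<subseteq> X \<Longrightarrow> \<not> prod_list (map S Ps) \<subseteq> M"
    by (auto simp: \<A>_def)
  have product_in_quotient: "\<exists>Ps. set Ps \<subseteq> X \<and> prod_list (map S Ps) \<subseteq> ideal_quotient M T"
    if "x \<in> ideal_quotient M T" "x \<notin> M" for x T
  proof (rule ccontr)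
    assume "\<not> ?thesis"
    moreover have "M \<subseteq> ideal_quotient M T"
      using ideal_subset_quotient ideal M(1) by blast
    ultimately have "ideal_quotient M T = M"
      using M quotient by (intro max) (auto simp: \<A>_def)
    then show False
      using that by simp
  qed
  have "prime_ideal M"
    unfolding prime_ideal_def
  proof (intro conjI allI impI)
    show "is_ideal M"
      using ideal M(1) .
    \<comment> \<open>The empty product of sets is \<open>{1}\<close>.\<close>
    show "M \<noteq> UNIV"
      using M(3)[of "[]"] by auto
    show "a \<in> M \<or> b \<in> M" if "a * b \<in> M" for a b
    proof (rule ccontr)
      assume notin: "\<not> (a \<in> M \<or> b \<in> M)"
      have "a \<in> ideal_quotient M {b}"
        using that by (simp add: ideal_quotient_def)
      then obtain Ps where Ps: "set Ps \<subseteq> X" "prod_list (map S Ps) \<subseteq> ideal_quotient M {b}"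
        using product_in_quotient notin by blast
      then have "b \<in> ideal_quotient M (prod_list (map S Ps))"
        by (auto simp: ideal_quotient_def mult.commute)
      then obtain Ps' where Ps': "set Ps' \<subseteq> X"
        "prod_list (map S Ps') \<subseteq> ideal_quotient M (prod_list (map S Ps))"
        using product_in_quotient notin by blast
      then have "prod_list (map S (Ps' @ Ps)) \<subseteq> M"
        by (auto simp: ideal_quotient_def elim!: set_times_elim)
      then show False
        using M(3)[of "Ps' @ Ps"] Ps(1) Ps'(1) by simp
    qed
  qed
  with M that show thesis
    by blast
qed

theorem finite_minimal_primes_of_finite_test_sets:
  assumes "I \<in> \<Q>"
    and radical: "\<And>P. P \<in> minimal_primes I \<Longrightarrow>
      \<exists>J S. finite_test_set \<Q> J S \<and> P = ideal_radical J"
  shows "finite (minimal_primes I)"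
proof -
  obtain J S where test: "\<And>P. P \<in> minimal_primes I \<Longrightarrow> finite_test_set \<Q> (J P) (S P)"
    and rad: "\<And>P. P \<in> minimal_primes I \<Longrightarrow> P = ideal_radical (J P)"
    using radical by metis
  show ?thesis
  proof (cases "\<exists>Ps. set Ps \<subseteq> minimal_primes I \<and> prod_list (map S Ps) \<subseteq> I")
    case True
    then obtain Ps where Ps: "set Ps \<subseteq> minimal_primes I" "prod_list (map S Ps) \<subseteq> I"
      by blast
    have "minimal_primes I \<subseteq> set Ps"
    proof
      fix Q
      assume Q: "Q \<in> minimal_primes I"
      then have "prime_ideal Q" "I \<subseteq> Q"
        by (auto simp: minimal_primes_def)
      then obtain P where P: "P \<in> set Ps" "J P \<subseteq> Q"
        using prime_over_product_contains_factor[of Q I S Ps J] assms(1) Ps test by blast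
      then have "P \<subseteq> Q"
        using prime_ideal_radical_subset[OF \<open>prime_ideal Q\<close>] rad Ps(1) by blast
      then have "P = Q"
        using Q P(1) Ps(1) unfolding minimal_primes_def by blast
      then show "Q \<in> set Ps"
        using P(1) by simp
    qed
    then show ?thesis
      by (rule finite_subset) simp
  next
    case False
    moreover have "finite (S P)" if "P \<in> minimal_primes I" for P
      using test[OF that] by (simp add: finite_test_set_def)
    ultimately obtain M where M: "prime_ideal M" "I \<subseteq> M"
      "\<And>Ps. set Ps \<subseteq> minimal_primes I \<Longrightarrow> \<not> prod_list (map S Ps) \<subseteq> M"
      using prime_avoiding_products[OF assms(1), of "minimal_primes I" S] by metis
    obtain P where P: "P \<in> minimal_primes I" "P \<subseteq> M"
      using prime_contains_minimal_prime M(1,2) .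
    have "S P \<subseteq> M"
      using test[OF P(1)] rad[OF P(1)] subset_ideal_radical[of "J P"] P(2)
      by (auto simp: finite_test_set_def)
    then have "prod_list (map S [P]) \<subseteq> M"
      by (auto elim!: set_times_elim)
    then show ?thesis
      using M(3)[of "[P]"] P(1) by simp
  qed
qed

end


section \<open>Quasi-star-ideals\<close>

lemma nonzero_submodulesD: "E \<in> nonzero_submodules \<Longrightarrow> module.subspace fract_scale E"
  by (simp add: nonzero_submodules_def)

lemma to_fract_ideal_in_nonzero_submodules:
  assumes "is_ideal A" "A \<noteq> {0}"
  shows "to_fract ` A \<in> nonzero_submodules"
proof -
  have "module.subspace fract_scale (to_fract ` A)"
    using assms(1)
    by (auto simp: module.subspace_def[OF module_fract_scale] is_ideal_iff fract_scale_def
        image_iff simp flip: to_fract_add to_fract_mult to_fract_0)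
  moreover obtain a where "a \<in> A" "a \<noteq> 0"
    using assms unfolding is_ideal_iff by blast
  then have "to_fract a \<in> to_fract ` A" "to_fract a \<noteq> 0"
    by auto
  then have "to_fract ` A \<noteq> {0}"
    by blast
  ultimately show ?thesis
    by (simp add: nonzero_submodules_def)
qed

lemma quasi_star_ideal_iff:
  assumes "semistar_operation star"
  shows "quasi_star_ideal star A \<longleftrightarrow>
    is_ideal A \<and> A \<noteq> {0} \<and> (\<forall>x. to_fract x \<in> star (to_fract ` A) \<longrightarrow> x \<in> A)"
proof -
  have "to_fract ` A \<subseteq> star (to_fract ` A)" if "is_ideal A" "A \<noteq> {0}"
    using assms to_fract_ideal_in_nonzero_submodules[OF that] by (auto simp: semistar_operation_def)
  then show ?thesis
    unfolding quasi_star_ideal_def by (auto simp: set_eq_iff image_iff) (metis to_fract_eq_iff)+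
qed

lemma star_mono:
  assumes "semistar_operation star" "E \<in> nonzero_submodules" "F \<in> nonzero_submodules" "E \<subseteq> F"
  shows "star E \<subseteq> star F"
  using assms by (simp add: semistar_operation_def)

lemma star_scale:
  assumes "semistar_operation star" "E \<in> nonzero_submodules" "x \<noteq> 0"
  shows "star ((*) x ` E) = (*) x ` star E"
  using assms by (simp add: semistar_operation_def)

lemma quasi_star_ideal_quotient:
  assumes star: "semistar_operation star" and A: "quasi_star_ideal star A"
  shows "quasi_star_ideal star (ideal_quotient A T)"
proof -
  let ?B = "ideal_quotient A T"
  have idA: "is_ideal A" "A \<noteq> {0}"
    and closed: "\<And>x. to_fract x \<in> star (to_fract ` A) \<Longrightarrow> x \<in> A"
    using A star by (auto simp: quasi_star_ideal_iff)
  have B: "is_ideal ?B"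
    using idA(1) by (rule ideal_quotient_ideal)
  have "?B \<noteq> {0}"
    using ideal_subset_quotient[OF idA(1), of T] idA by (auto simp: is_ideal_iff)
  then have B': "to_fract ` ?B \<in> nonzero_submodules"
    by (rule to_fract_ideal_in_nonzero_submodules[OF B])
  have "x * t \<in> A" if x: "to_fract x \<in> star (to_fract ` ?B)" and t: "t \<in> T" for x t
  proof (cases "t = 0")
    case True
    then show ?thesis
      using idA(1) by (simp add: is_ideal_iff)
  next
    case False
    let ?tB = "(*) t ` ?B"
    have "is_ideal ?tB"
      using B by (auto simp: is_ideal_iff mult.left_commute simp flip: distrib_left)
    moreover obtain b where "b \<in> ?B" "b \<noteq> 0"
      using B \<open>?B \<noteq> {0}\<close> unfolding is_ideal_iff by blast
    then have "t * b \<in> ?tB" "t * b \<noteq> 0"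
      using False by auto
    then have "?tB \<noteq> {0}"
      by blast
    ultimately have tB: "to_fract ` ?tB \<in> nonzero_submodules"
      by (rule to_fract_ideal_in_nonzero_submodules)
    have "to_fract t * to_fract x \<in> (*) (to_fract t) ` star (to_fract ` ?B)"
      using x by (rule imageI)
    also have "\<dots> = star ((*) (to_fract t) ` to_fract ` ?B)"
      using star_scale[OF star B'] False by simp
    also have "(*) (to_fract t) ` to_fract ` ?B = to_fract ` ?tB"
      by (simp add: image_image)
    also have "star (to_fract ` ?tB) \<subseteq> star (to_fract ` A)"
      using t by (intro star_mono[OF star tB] to_fract_ideal_in_nonzero_submodules idA)
        (auto simp: ideal_quotient_def mult.commute)
    finally show ?thesis
      using closed[of "x * t"] by (simp add: mult.commute)
  qed
  then have "x \<in> ?B" if "to_fract x \<in> star (to_fract ` ?B)" for x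
    using that by (auto simp: ideal_quotient_def)
  then show ?thesis
    using B \<open>?B \<noteq> {0}\<close> star by (auto simp: quasi_star_ideal_iff)
qed

text \<open>
  Finite type in the form in which it is used: an element of the closure of an ideal \<open>A\<close> already
  lies in the closure of the submodule generated by finitely many elements of \<open>A\<close>.
\<close>

lemma finite_type_star_idealE:
  assumes "finite_type star" "is_ideal A" "A \<noteq> {0}" "x \<in> star (to_fract ` A)"
  obtains S where "finite S" "S \<subseteq> A"
    "module.span fract_scale (to_fract ` S) \<in> nonzero_submodules"
    "x \<in> star (module.span fract_scale (to_fract ` S))"
proof -
  have "x \<in> semistar_f star (to_fract ` A)"
    using assms(1,4) to_fract_ideal_in_nonzero_submodules[OF assms(2,3)]
    by (auto simp: finite_type_def)
  then obtain F where F: "F \<in> fg_fractional_ideals" "F \<subseteq> to_fract ` A" "x \<in> star F"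
    by (auto simp: semistar_f_def)
  then obtain T where T: "F \<in> nonzero_submodules" "finite T" "F = module.span fract_scale T"
    by (auto simp: fg_fractional_ideals_def)
  then have "T \<subseteq> to_fract ` A"
    using F(2) module.span_superset[OF module_fract_scale, of T] by blast
  then obtain S where "finite S" "S \<subseteq> A" "T = to_fract ` S"
    using finite_subset_image[OF T(2)] by metis
  with T F(3) that show thesis
    by blast
qed

lemma span_subset_ideal:
  assumes "is_ideal A" "A \<noteq> {0}" "S \<subseteq> A"
  shows "module.span fract_scale (to_fract ` S) \<subseteq> to_fract ` A"
  using assms nonzero_submodulesD[OF to_fract_ideal_in_nonzero_submodules[OF assms(1,2)]]
  by (intro module.span_minimal[OF module_fract_scale]) auto

lemma quasi_star_ideal_Union_chain:
  assumes star: "semistar_operation star" "finite_type star"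
    and "\<C> \<noteq> {}" and chain: "subset.chain {A. quasi_star_ideal star A} \<C>"
  shows "quasi_star_ideal star (\<Union>\<C>)"
proof -
  have mem: "is_ideal A" "A \<noteq> {0}" "\<And>x. to_fract x \<in> star (to_fract ` A) \<Longrightarrow> x \<in> A"
    if "A \<in> \<C>" for A
    using chain that star(1) by (auto simp: subset_chain_def quasi_star_ideal_iff)
  have U: "is_ideal (\<Union>\<C>)"
    using assms(3) chain mem(1) by (rule ideal_Union_chain)
  have U0: "\<Union>\<C> \<noteq> {0}"
    using assms(3) mem(1,2) by (fastforce simp: is_ideal_iff)
  have "x \<in> \<Union>\<C>" if "to_fract x \<in> star (to_fract ` \<Union>\<C>)" for x
  proof -
    obtain S where S: "finite S" "S \<subseteq> \<Union>\<C>"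
      "module.span fract_scale (to_fract ` S) \<in> nonzero_submodules"
      "to_fract x \<in> star (module.span fract_scale (to_fract ` S))"
      using finite_type_star_idealE[OF star(2) U U0 \<open>to_fract x \<in> star (to_fract ` \<Union>\<C>)\<close>] .
    obtain A where A: "A \<in> \<C>" "S \<subseteq> A"
      using finite_subset_Union_chain[OF S(1,2) assms(3) chain] .
    have "star (module.span fract_scale (to_fract ` S)) \<subseteq> star (to_fract ` A)"
      using mem[OF A(1)] A(2)
      by (intro star_mono[OF star(1) S(3)] to_fract_ideal_in_nonzero_submodules span_subset_ideal)
    then show ?thesis
      using S(4) mem(3)[OF A(1)] A(1) by blast
  qed
  with U U0 star(1) show ?thesis
    by (auto simp: quasi_star_ideal_iff)
qed

text \<open>
  Finitely many elements \<open>T\<close> of \<open>K\<close>, not necessarily in \<open>J\<close>, generate a submodule with the same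
  closure as \<open>J\<close>. By finite type, each of them lies in the closure of finitely many elements of
  \<open>J\<close>; all these elements together form the test set.
\<close>

lemma star_finite_has_finite_test_set:
  assumes star: "semistar_operation star" "finite_type star"
    and J: "is_ideal J" "star_finite star (to_fract ` J)"
  shows "\<exists>S. finite_test_set {A. quasi_star_ideal star A} J S"
proof -
  let ?span = "module.span fract_scale"
  have J': "to_fract ` J \<in> nonzero_submodules"
    using J(2) by (simp add: star_finite_def)
  then have J0: "J \<noteq> {0}"
    by (auto simp: nonzero_submodules_def)
  have extensive: "E \<subseteq> star E" and star_submodule: "star E \<in> nonzero_submodules"
    and idem: "star (star E) = star E" if "E \<in> nonzero_submodules" for E
    using star(1) that by (auto simp: semistar_operation_def)
  obtain T where T: "finite T" "?span T \<in> nonzero_submodules" "star (to_fract ` J) = star (?span T)"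
    using J(2) by (auto simp: star_finite_def fg_fractional_ideals_def)
  have "T \<subseteq> star (to_fract ` J)"
    using extensive[OF T(2)] module.span_superset[OF module_fract_scale, of T] T(3) by blast
  then have "\<forall>t\<in>T. \<exists>S. finite S \<and> S \<subseteq> J \<and> ?span (to_fract ` S) \<in> nonzero_submodules
      \<and> t \<in> star (?span (to_fract ` S))"
    using finite_type_star_idealE[OF star(2) J(1) J0] by (metis subsetD)
  then obtain G where G: "\<And>t. t \<in> T \<Longrightarrow> finite (G t)" "\<And>t. t \<in> T \<Longrightarrow> G t \<subseteq> J"
    "\<And>t. t \<in> T \<Longrightarrow> ?span (to_fract ` G t) \<in> nonzero_submodules"
    "\<And>t. t \<in> T \<Longrightarrow> t \<in> star (?span (to_fract ` G t))"
    by metis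
  define S where "S = (\<Union>t\<in>T. G t)"
  have "J \<subseteq> A" if A: "quasi_star_ideal star A" and "S \<subseteq> A" for A
  proof -
    have idA: "is_ideal A" "A \<noteq> {0}"
      and closed: "\<And>x. to_fract x \<in> star (to_fract ` A) \<Longrightarrow> x \<in> A"
      using A star(1) by (auto simp: quasi_star_ideal_iff)
    have A': "to_fract ` A \<in> nonzero_submodules"
      using idA by (rule to_fract_ideal_in_nonzero_submodules)
    have "T \<subseteq> star (to_fract ` A)"
    proof
      fix t
      assume "t \<in> T"
      then have "G t \<subseteq> A"
        using \<open>S \<subseteq> A\<close> by (auto simp: S_def)
      then have "star (?span (to_fract ` G t)) \<subseteq> star (to_fract ` A)"
        using \<open>t \<in> T\<close> by (intro star_mono[OF star(1) G(3) A'] span_subset_ideal idA)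
      then show "t \<in> star (to_fract ` A)"
        using G(4)[OF \<open>t \<in> T\<close>] by blast
    qed
    then have "?span T \<subseteq> star (to_fract ` A)"
      by (intro module.span_minimal[OF module_fract_scale]
          nonzero_submodulesD star_submodule A')
    then have "star (?span T) \<subseteq> star (to_fract ` A)"
      using star_mono[OF star(1) T(2) star_submodule[OF A']] idem[OF A'] by simp
    then have "to_fract ` J \<subseteq> star (to_fract ` A)"
      using extensive[OF J'] T(3) by simp
    then show ?thesis
      using closed by blast
  qed
  then have "finite_test_set {A. quasi_star_ideal star A} J S"
    using G(1,2) T(1) unfolding finite_test_set_def S_def by blast
  then show ?thesis ..
qed

theorem theorem2p3:
  fixes star :: "'a::idom fract set \<Rightarrow> 'a fract set" and I :: "'a set"
  assumes "semistar_operation star"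
    and "finite_type star"
    and "quasi_star_ideal star I"
    and "\<And>P. P \<in> minimal_primes I \<Longrightarrow>
           \<exists>J. is_ideal J \<and> star_finite star (to_fract ` J) \<and> P = ideal_radical J"
  shows "finite (minimal_primes I)"
proof -
  interpret quotient_chain_closed "{A. quasi_star_ideal star A}"
    using quasi_star_ideal_quotient[OF assms(1)] quasi_star_ideal_Union_chain[OF assms(1,2)]
    by unfold_locales (auto simp: quasi_star_ideal_def)
  show ?thesis
  proof (rule finite_minimal_primes_of_finite_test_sets)
    show "I \<in> {A. quasi_star_ideal star A}"
      using assms(3) by simp
  next
    fix P
    assume "P \<in> minimal_primes I"
    then show "\<exists>J S. finite_test_set {A. quasi_star_ideal star A} J S \<and> P = ideal_radical J"
      using assms(4) star_finite_has_finite_test_set[OF assms(1,2)] by blast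
  qed
qed

end
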